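(* Let $a,b,d$ be pairwise coprime odd integers with $d>1$, and let $\beta\ge 2$ be an integer. Then $2^{\beta}d\in G_{(a,b)}$ if and only if $ab^{-1}\equiv -1\pmod{2^{\beta}}$ and $2\,\|\,\mathrm{Ord}_p(ab^{-1})$ for every prime $p$ dividing $d$.
   Context: For coprime nonzero integers $a,b$, a positive integer $\ell$ is called good (with respect to $a$ and $b$) if there exists a positive integer $k$ such that $\ell\mid a^k+b^k$; $G_{(a,b)}$ denotes the set of all good integers with respect to $a$ and $b$. Here $b^{-1}$ denotes the multiplicative inverse of $b$ modulo $2^{\beta}d$, and for a divisor $m$ of $2^{\beta}d$, $\mathrm{Ord}_m(ab^{-1})$ denotes the multiplicative order of $ab^{-1}$ modulo $m$. The notation $2^{\gamma}\,\|\,n$ means that $\gamma$ is the largest integer such that $2^{\gamma}\mid n$. *)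

theory Defs
  imports "HOL-Number_Theory.Number_Theory"
begin

definition good :: "int \<Rightarrow> int \<Rightarrow> int \<Rightarrow> bool" where
  "good a b l \<longleftrightarrow> l > 0 \<and> (\<exists>k::nat. k > 0 \<and> l dvd a ^ k + b ^ k)"

definition good_integers :: "int \<Rightarrow> int \<Rightarrow> int set" where
  "good_integers a b = {l. good a b l}"

end

theory Submission
  imports Defs
begin

text \<open>
  Multiplying by powers of \<open>b\<close> shows that \<open>2 ^ \<beta> * d\<close> is good for \<open>a, b\<close> exactly
  when some power \<open>c ^ k\<close> with \<open>k > 0\<close> is \<open>-1\<close> modulo \<open>2 ^ \<beta> * d\<close>, where \<open>c\<close> is \<open>a\<close>
  divided by \<open>b\<close>.

  The factor \<open>2 ^ \<beta>\<close> is divisible by 4, and an even power of an odd number is 1 modulo 4;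
  so the exponent must be odd. For odd \<open>k\<close> the cofactor of \<open>c + 1\<close> in \<open>c ^ k + 1\<close> is a sum of
  \<open>k\<close> odd terms and hence odd, so that \<open>2 ^ \<beta>\<close> divides \<open>c ^ k + 1\<close> if and only if it divides
  \<open>c + 1\<close>. For a prime \<open>p > 2\<close>, having an odd power equal to \<open>-1\<close> modulo \<open>p\<close> says precisely
  that the order of \<open>c\<close> is twice an odd number (\<open>two_exactly_divides_ord_iff\<close>). This settles
  one direction.

  For the converse, the odd exponents belonging to the single primes have to be merged into
  one for the whole modulus. The tool is \<open>odd_power_plus_one_mult\<close>: if \<open>m\<close> and the odd number
  \<open>n\<close> each divide some \<open>c ^ k + 1\<close> with odd \<open>k\<close>, so does \<open>m * n\<close>. As \<open>m\<close> and \<open>n\<close> may share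
  factors, this handles prime powers and products of different primes at the same time.
\<close>

section \<open>Sums of an odd power and one\<close>

text \<open>
  The quotient of \<open>x ^ k + 1\<close> by \<open>x + 1\<close>. It is useful for its residues: modulo a divisor of
  \<open>x + 1\<close> all its terms are 1, and for odd \<open>x\<close> all its terms are odd.
\<close>

lemma odd_power_plus_one_factor:
  fixes x :: "'a :: comm_ring_1"
  assumes "odd k"
  shows "x ^ k + 1 = (x + 1) * (\<Sum>i<k. (- x) ^ i)"
proof -
  have "(- x) ^ k - 1 = (- x - 1) * (\<Sum>i<k. (- x) ^ i)"
    by (rule power_diff_1_eq)
  with assms show ?thesis
    by (simp add: algebra_simps)
qed

corollary plus_one_dvd_odd_power_plus_one:
  fixes x :: "'a :: comm_ring_1"
  assumes "odd k"
  shows "x + 1 dvd x ^ k + 1"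
  using assms by (simp add: odd_power_plus_one_factor)

text \<open>
  With \<open>x = c ^ (k * l)\<close>, both \<open>m\<close> and \<open>n\<close> divide \<open>x + 1\<close>. Let \<open>q\<close> be the absolute value of
  \<open>n\<close>. Then \<open>x ^ q + 1\<close> is \<open>x + 1\<close>, which takes care of \<open>m\<close>, times a sum of \<open>q\<close> terms that are
  all 1 modulo \<open>n\<close>, which takes care of \<open>n\<close>.
\<close>

lemma odd_power_plus_one_mult:
  fixes c m n :: int
  assumes "odd k" "m dvd c ^ k + 1" and "odd l" "n dvd c ^ l + 1" and "odd n"
  shows "\<exists>j. odd j \<and> m * n dvd c ^ j + 1"
proof -
  define x where "x = c ^ (k * l)"
  have "m dvd x + 1"
    using plus_one_dvd_odd_power_plus_one[OF assms(3), of "c ^ k"] assms(2)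
    by (simp add: x_def power_mult dvd_trans)
  have "n dvd x + 1"
    using plus_one_dvd_odd_power_plus_one[OF assms(1), of "c ^ l"] assms(4)
    by (simp add: x_def power_mult mult.commute[of k] dvd_trans)
  define q where "q = nat \<bar>n\<bar>"
  have "odd q"
    using \<open>odd n\<close> by (simp add: q_def even_nat_iff)
  have "[- x = 1] (mod n)"
    using \<open>n dvd x + 1\<close> by (metis add.inverse_inverse cong_iff_dvd_diff cong_minus_minus_iff diff_minus_eq_add)
  then have "[(\<Sum>i<q. (- x) ^ i) = (\<Sum>i<q. 1 ^ i)] (mod n)"
    by (intro cong_sum cong_pow)
  then have "n dvd (\<Sum>i<q. (- x) ^ i)"
    by (simp add: q_def cong_dvd_iff)
  then have "m * n dvd x ^ q + 1"
    using \<open>m dvd x + 1\<close> \<open>odd q\<close> by (simp add: odd_power_plus_one_factor mult_dvd_mono)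
  moreover have "x ^ q = c ^ (k * l * q)"
    by (simp add: x_def power_mult)
  ultimately show ?thesis
    using \<open>odd k\<close> \<open>odd l\<close> \<open>odd q\<close> by (metis even_mult_iff)
qed

lemma odd_power_plus_one_of_primes:
  fixes c d :: int
  assumes "odd d"
    and "\<And>p. prime p \<Longrightarrow> p dvd d \<Longrightarrow> \<exists>k. odd k \<and> p dvd c ^ k + 1"
  shows "\<exists>k. odd k \<and> d dvd c ^ k + 1"
  using assms
proof (induction d rule: prime_divisors_induct)
  case zero
  then show ?case by simp
next
  case (unit d)
  then show ?case by (intro exI[of _ 1]) (simp add: unit_imp_dvd)
next
  case (factor p d)
  from factor.prems have "odd p" "odd d" by simp_all
  moreover from factor.prems(2) have "\<exists>k. odd k \<and> d dvd c ^ k + 1"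
    using \<open>odd d\<close> by (intro factor.IH) auto
  moreover from factor.prems(2) have "\<exists>l. odd l \<and> p dvd c ^ l + 1"
    using factor.hyps by simp
  ultimately show ?case
    using odd_power_plus_one_mult by (metis mult.commute)
qed

section \<open>Orders modulo an odd prime\<close>

text \<open>
  Over the natural numbers this is \<open>ord_divides\<close>. Reducing \<open>c\<close> to its remainder modulo \<open>n\<close>,
  which is a natural number, carries it over to the integers.
\<close>

lemma ord_dvd_iff_int:
  fixes n c :: int
  assumes "n > 0"
  shows "ord n c dvd k \<longleftrightarrow> n dvd c ^ k - 1"
proof -
  define m r where "m = nat n" and "r = nat (c mod n)"
  have n: "n = int m" and r: "c mod n = int r"
    using assms by (simp_all add: m_def r_def)
  have pow: "[c ^ j = 1] (mod n) \<longleftrightarrow> [r ^ j = 1] (mod m)" for j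
  proof -
    have "[c ^ j = 1] (mod n) \<longleftrightarrow> [(c mod n) ^ j = 1] (mod n)"
      by (simp add: cong_def power_mod)
    also have "\<dots> \<longleftrightarrow> [int (r ^ j) = int 1] (mod int m)"
      unfolding r by (simp add: n)
    finally show ?thesis
      by (simp only: cong_int_iff)
  qed
  have "coprime n c \<longleftrightarrow> coprime n (c mod n)"
    using assms by (simp add: coprime_commute)
  also have "\<dots> \<longleftrightarrow> coprime m r"
    unfolding r by (simp add: n)
  finally have "ord n c = ord m r"
    by (simp add: ord_def pow)
  then have "ord n c dvd k \<longleftrightarrow> [c ^ k = 1] (mod n)"
    by (simp only: pow ord_divides)
  then show ?thesis
    by (simp add: cong_iff_dvd_diff)
qed

text \<open>
  If \<open>c ^ k = -1\<close> modulo \<open>p\<close> with \<open>k\<close> odd, the order of \<open>c\<close> divides \<open>2 * k\<close> but not \<open>k\<close>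
  (as \<open>-1\<close> is not 1 modulo an odd prime), so it contains the factor 2 once. Conversely, if the order is \<open>2 * m\<close>, then \<open>c ^ m\<close> is a square
  root of 1 other than 1, which modulo a prime leaves only \<open>-1\<close>.
\<close>

lemma two_exactly_divides_ord_iff:
  fixes p c :: int
  assumes "prime p" "odd p"
  shows "multiplicity 2 (ord p c) = 1 \<longleftrightarrow> (\<exists>k. odd k \<and> p dvd c ^ k + 1)"
proof
  note ord_dvd_iff = ord_dvd_iff_int[OF prime_gt_0_int[OF \<open>prime p\<close>], of c]
  assume *: "multiplicity 2 (ord p c) = 1"
  have "ord p c \<noteq> 0"
    using * by (intro notI) simp
  then obtain m where m: "ord p c = 2 * m" "odd m"
    using multiplicity_decompose'[of "ord p c" 2] * by auto
  have "m > 0"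
    using m(2) by (rule odd_pos)
  have "p dvd (c ^ m) ^ 2 - 1"
    using ord_dvd_iff[of "2 * m"] m(1) by (simp add: power_mult mult.commute[of 2])
  then have "p dvd (c ^ m - 1) * (c ^ m + 1)"
    by (simp add: algebra_simps power2_eq_square)
  moreover have "\<not> p dvd c ^ m - 1"
    using ord_dvd_iff[of m] m(1) \<open>m > 0\<close> by (auto dest: dvd_imp_le)
  ultimately have "p dvd c ^ m + 1"
    using \<open>prime p\<close> prime_dvd_mult_iff by blast
  with m(2) show "\<exists>k. odd k \<and> p dvd c ^ k + 1" by blast
next
  note ord_dvd_iff = ord_dvd_iff_int[OF prime_gt_0_int[OF \<open>prime p\<close>], of c]
  assume "\<exists>k. odd k \<and> p dvd c ^ k + 1"
  then obtain k where k: "odd k" "p dvd c ^ k + 1" by blast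
  have "p dvd (c ^ k - 1) * (c ^ k + 1)"
    using k(2) by simp
  then have "p dvd c ^ (2 * k) - 1"
    by (simp add: algebra_simps power2_eq_square power_mult mult.commute[of 2])
  then have "ord p c dvd 2 * k"
    by (simp add: ord_dvd_iff)
  have "\<not> ord p c dvd k"
  proof
    assume "ord p c dvd k"
    then have "p dvd c ^ k - 1"
      by (simp add: ord_dvd_iff)
    from dvd_diff[OF k(2) this] have "p dvd 2" by simp
    with assms show False
      by (metis dvd_refl primes_dvd_imp_eq two_is_prime)
  qed
  have "even (ord p c)"
    using \<open>ord p c dvd 2 * k\<close> \<open>\<not> ord p c dvd k\<close> by (metis coprime_dvd_mult_right_iff coprime_right_2_iff_odd)
  then obtain m where m: "ord p c = 2 * m" ..
  with \<open>ord p c dvd 2 * k\<close> k(1) have "odd m" by auto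
  with m have "\<not> 2 ^ Suc 1 dvd ord p c" by auto
  with \<open>even (ord p c)\<close> show "multiplicity 2 (ord p c) = 1"
    by (intro multiplicity_eqI) auto
qed

section \<open>Exponents modulo powers of two\<close>

text \<open>
  An even \<open>k\<close> would make \<open>c ^ k\<close> a square and hence never \<open>-1\<close> modulo 4.
\<close>

lemma four_dvd_power_plus_one_imp_odd_exponent:
  fixes c :: int
  assumes "4 dvd c ^ k + 1"
  shows "odd k"
proof
  assume "even k"
  then obtain j where "c ^ k = (c ^ j)\<^sup>2"
    by (auto elim!: evenE simp: power_mult mult.commute[of 2])
  moreover have "y\<^sup>2 mod 4 \<in> {0, 1}" for y :: int
  proof (cases "even y")
    case True
    then show ?thesis by (auto elim!: evenE simp: power2_eq_square)
  next
    case False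
    then obtain z where "y = 2 * z + 1" ..
    then have "y\<^sup>2 = 1 + 4 * (z\<^sup>2 + z)"
      by (simp add: power2_eq_square algebra_simps)
    then have "[y\<^sup>2 = 1] (mod 4)"
      by (simp only: cong_iff_dvd_diff) simp
    then show ?thesis by (simp add: cong_def)
  qed
  ultimately have "c ^ k mod 4 \<in> {0, 1}" by simp
  moreover have "(c ^ k mod 4 + 1) mod 4 = 0"
    using assms by (simp add: mod_simps dvd_eq_mod_eq_0)
  ultimately show False by auto
qed

text \<open>
  The cofactor of \<open>c + 1\<close> in \<open>c ^ k + 1\<close> is congruent to \<open>k\<close> modulo 2, so it contributes no
  factor 2.
\<close>

lemma two_power_dvd_odd_power_plus_one_iff:
  fixes c :: int
  assumes "odd c" "odd k"
  shows "2 ^ n dvd c ^ k + 1 \<longleftrightarrow> 2 ^ n dvd c + 1"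
proof -
  have "odd (\<Sum>i<k. (- c) ^ i)"
    using assms by (simp add: even_sum_iff)
  then have "coprime (2 ^ n) (\<Sum>i<k. (- c) ^ i)"
    by simp
  then show ?thesis
    using \<open>odd k\<close> by (simp add: odd_power_plus_one_factor coprime_dvd_mult_left_iff)
qed

section \<open>Good integers\<close>

text \<open>
  As \<open>a\<close> is \<open>b * c\<close> modulo \<open>n\<close> for the quotient \<open>c\<close>, the unit \<open>b ^ k\<close> can be factored out of
  \<open>a ^ k + b ^ k\<close>.
\<close>

lemma dvd_power_sum_iff_modular_inverse:
  fixes a b n :: int
  assumes "coprime b n"
  shows "n dvd a ^ k + b ^ k \<longleftrightarrow> n dvd (a * modular_inverse n b) ^ k + 1"
proof -
  define c where "c = a * modular_inverse n b"
  have "[b * c = a] (mod n)"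
    using cong_scalar_left[OF cong_modular_inverse1[OF assms], of a]
    by (simp add: c_def mult_ac)
  then have "[(b * c) ^ k + b ^ k = a ^ k + b ^ k] (mod n)"
    by (intro cong_add cong_pow cong_refl)
  then have "n dvd a ^ k + b ^ k \<longleftrightarrow> n dvd b ^ k * (c ^ k + 1)"
    by (simp add: cong_dvd_iff algebra_simps power_mult_distrib cong_sym_eq)
  also have "\<dots> \<longleftrightarrow> n dvd c ^ k + 1"
    using assms by (simp add: coprime_commute coprime_dvd_mult_right_iff)
  finally show ?thesis by (simp add: c_def)
qed

theorem proposition2:
  fixes a b d :: int and \<beta> :: nat
  assumes "coprime a b" and "coprime a d" and "coprime b d"
    and "odd a" and "odd b" and "odd d"
    and "d > 1" and "\<beta> \<ge> 2"
  shows "2 ^ \<beta> * d \<in> good_integers a b \<longleftrightarrow>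
    (let c = a * modular_inverse (2 ^ \<beta> * d) b
     in [c = -1] (mod 2 ^ \<beta>) \<and>
        (\<forall>p. prime p \<longrightarrow> p dvd d \<longrightarrow> multiplicity 2 (ord p c) = 1))"
proof -
  define N where "N = 2 ^ \<beta> * d"
  define c where "c = a * modular_inverse N b"
  have "coprime b N"
    using assms by (simp add: N_def)
  then have "coprime (modular_inverse N b) N"
    by (rule coprime_modular_inverse)
  then have "odd c"
    using assms by (simp add: c_def N_def)
  have "N \<in> good_integers a b \<longleftrightarrow> (\<exists>k>0. N dvd c ^ k + 1)"
    using assms dvd_power_sum_iff_modular_inverse[OF \<open>coprime b N\<close>, of a]
    by (simp add: good_integers_def good_def c_def N_def)
  also have "\<dots> \<longleftrightarrow> (\<exists>k. odd k \<and> N dvd c ^ k + 1)"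
  proof -
    have "4 dvd N"
      using le_imp_power_dvd[OF \<open>\<beta> \<ge> 2\<close>, of "2 :: int"] by (simp add: N_def)
    then show ?thesis
      using four_dvd_power_plus_one_imp_odd_exponent dvd_trans odd_pos by metis
  qed
  also have "\<dots> \<longleftrightarrow> 2 ^ \<beta> dvd c + 1 \<and> (\<forall>p. prime p \<longrightarrow> p dvd d \<longrightarrow> (\<exists>k. odd k \<and> p dvd c ^ k + 1))"
  proof (intro iffI conjI; (elim conjE)?)
    assume "\<exists>k. odd k \<and> N dvd c ^ k + 1"
    then obtain k where k: "odd k" "2 ^ \<beta> dvd c ^ k + 1" "d dvd c ^ k + 1"
      using dvd_mult_left dvd_mult_right unfolding N_def by blast
    show "2 ^ \<beta> dvd c + 1"
      using k \<open>odd c\<close> by (simp add: two_power_dvd_odd_power_plus_one_iff)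
    show "\<forall>p. prime p \<longrightarrow> p dvd d \<longrightarrow> (\<exists>k. odd k \<and> p dvd c ^ k + 1)"
      using k dvd_trans by blast
  next
    assume "2 ^ \<beta> dvd c + 1"
      and "\<forall>p. prime p \<longrightarrow> p dvd d \<longrightarrow> (\<exists>k. odd k \<and> p dvd c ^ k + 1)"
    with odd_power_plus_one_of_primes[OF \<open>odd d\<close>, of c]
    obtain l where "odd l" "d dvd c ^ l + 1" by blast
    \<comment> \<open>When two moduli are merged, the first may be even: here it is the power of 2, with
      exponent 1.\<close>
    with \<open>2 ^ \<beta> dvd c + 1\<close> \<open>odd d\<close> show "\<exists>k. odd k \<and> N dvd c ^ k + 1"
      using odd_power_plus_one_mult[of 1 "2 ^ \<beta>" c l d] by (simp add: N_def)
  qed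
  also have "\<dots> \<longleftrightarrow> [c = -1] (mod 2 ^ \<beta>) \<and>
      (\<forall>p. prime p \<longrightarrow> p dvd d \<longrightarrow> multiplicity 2 (ord p c) = 1)"
  proof -
    have "odd p" if "p dvd d" for p
      using that \<open>odd d\<close> dvd_trans by blast
    then have "multiplicity 2 (ord p c) = 1 \<longleftrightarrow> (\<exists>k. odd k \<and> p dvd c ^ k + 1)"
      if "prime p" "p dvd d" for p
      using that by (intro two_exactly_divides_ord_iff)
    moreover have "[c = -1] (mod 2 ^ \<beta>) \<longleftrightarrow> 2 ^ \<beta> dvd c + 1"
      by (simp add: cong_iff_dvd_diff)
    ultimately show ?thesis by blast
  qed
  finally show ?thesis
    by (simp only: N_def c_def Let_def)
qed

end
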